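(* Let $t>0$ be given. Then for arbitrary $\beta>0$ there exists a constant $L$, depending on the parameter $\delta$ of the weight function $w$, such that $$\mathbb P\Big[\exists\,\mathbf u=(U,U)\in\mathcal A:\ |\widehat\phi_n(\mathbf u)-\phi_n(\mathbf u)|\ge t\Big(\frac{\log n}{n}\Big)^{1/2}(w(U))^{-1}\Big]\le L\,n^{-\frac{(t-\beta)^2}{c_1}},$$ where $c_1$ is the constant in the Talagrand-type inequality recalled in the context.
   Context: $X=(X_t)_{t\ge0}$ is a two-dimensional Lévy process observed at times $j/n$, $j=0,\dots,n$; $\Delta_j^nX=X_{j/n}-X_{(j-1)/n}$; $\phi_n(\mathbf u)=\mathbb E[e^{i\langle\mathbf u,X_{1/n}\rangle}]$; $\widehat\phi_n(\mathbf u)=\frac1n\sum_{j=1}^ne^{i\langle\mathbf u,\Delta^n_jX\rangle}$. $\mathcal A=\{\mathbf u\in\mathbb R^2:\mathbf u=(U,U),U\in\mathbb R\}$. For a fixed $\delta>0$, $w(U)=(\log(e+|U|))^{-1/2-\delta}$. Constant $c_1$: it is a positive constant such that for every $\epsilon>0$ there is $c_2=c_2(\epsilon)>0$ such that, for every countable family $(\mathbf u_j)_{j\in\mathcal I}$ in $\mathcal A$ and every $x>0$, $\mathbb P\big[\sup_{j}|\widehat\phi_n(\mathbf u_j)-\phi_n(\mathbf u_j)|\ge(1+\epsilon)\mathbb E[\sup_j|\widehat\phi_n(\mathbf u_j)-\phi_n(\mathbf u_j)|]+x\big]\le2\exp\big(-n(\frac{x^2}{c_1}\wedge\frac{x}{c_2})\big)$.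 *)

theory Defs
  imports "HOL-Probability.Probability"
begin

locale levy_process = prob_space M
  for M :: "'a measure" and X :: "real \<Rightarrow> 'a \<Rightarrow> 'b::euclidean_space" +
  assumes measurable_X: "\<And>t. 0 \<le> t \<Longrightarrow> X t \<in> borel_measurable M"
    and start_at_zero: "AE \<omega> in M. X 0 \<omega> = 0"
    and independent_increments:
      "\<And>(m::nat) (s::nat \<Rightarrow> real). 0 \<le> s 0 \<Longrightarrow> (\<And>i. i < m \<Longrightarrow> s i \<le> s (Suc i)) \<Longrightarrow>
         indep_vars (\<lambda>_. borel) (\<lambda>i \<omega>. X (s (Suc i)) \<omega> - X (s i) \<omega>) {..<m}"
    and stationary_increments:
      "\<And>s h. 0 \<le> s \<Longrightarrow> 0 \<le> h \<Longrightarrow>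
         distr M borel (\<lambda>\<omega>. X (s + h) \<omega> - X s \<omega>) = distr M borel (X h)"
    and stochastically_continuous:
      "\<And>t \<epsilon>. 0 \<le> t \<Longrightarrow> 0 < \<epsilon> \<Longrightarrow>
         ((\<lambda>s. prob {\<omega> \<in> space M. dist (X s \<omega>) (X t \<omega>) > \<epsilon>}) \<longlongrightarrow> 0) (at t within {0..})"
    and cadlag_paths:
      "AE \<omega> in M. \<forall>t\<ge>0. ((\<lambda>s. X s \<omega>) \<longlongrightarrow> X t \<omega>) (at_right t) \<and>
         (0 < t \<longrightarrow> (\<exists>l. ((\<lambda>s. X s \<omega>) \<longlongrightarrow> l) (at_left t)))"

definition diagonal :: "(real \<times> real) set" where
  "diagonal = {u. \<exists>U. u = (U, U)}"

definition increment :: "(real \<Rightarrow> 'a \<Rightarrow> real \<times> real) \<Rightarrow> nat \<Rightarrow> nat \<Rightarrow> 'a \<Rightarrow> real \<times> real" where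
  "increment X n j \<omega> = X (real j / real n) \<omega> - X ((real j - 1) / real n) \<omega>"

definition cf :: "'a measure \<Rightarrow> (real \<Rightarrow> 'a \<Rightarrow> real \<times> real) \<Rightarrow> nat \<Rightarrow> real \<times> real \<Rightarrow> complex" where
  "cf M X n u = (LINT \<omega>|M. iexp (u \<bullet> X (1 / real n) \<omega>))"

definition empirical_cf ::
    "(real \<Rightarrow> 'a \<Rightarrow> real \<times> real) \<Rightarrow> nat \<Rightarrow> real \<times> real \<Rightarrow> 'a \<Rightarrow> complex" where
  "empirical_cf X n u \<omega> = (1 / of_nat n) * (\<Sum>j=1..n. iexp (u \<bullet> increment X n j \<omega>))"

definition weight :: "real \<Rightarrow> real \<Rightarrow> real" where
  "weight \<delta> U = (ln (exp 1 + \<bar>U\<bar>)) powr (- 1 / 2 - \<delta>)"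

text \<open>
  Admissible values of the leading constant in the Talagrand-type inequality. The second constant
  depends only on \<open>\<epsilon>\<close>; in particular it is uniform in the number \<open>n\<close> of observations. A countable
  family is indexed by a set of naturals; the index set is nonempty because \<open>Sup {}\<close> is unspecified
  on the reals (with the convention that it is 0, the inequality is trivial there).
\<close>
definition talagrand_constant :: "'a measure \<Rightarrow> (real \<Rightarrow> 'a \<Rightarrow> real \<times> real) \<Rightarrow> real \<Rightarrow> bool" where
  "talagrand_constant M X c\<^sub>1 \<longleftrightarrow> 0 < c\<^sub>1 \<and>
     (\<forall>\<epsilon>>0. \<exists>c\<^sub>2>0. \<forall>n\<ge>1. \<forall>(I::nat set) u. I \<noteq> {} \<longrightarrow> u ` I \<subseteq> diagonal \<longrightarrow> (\<forall>x>0.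
        measure M {\<omega> \<in> space M.
            (SUP j\<in>I. norm (empirical_cf X n (u j) \<omega> - cf M X n (u j)))
              \<ge> (1 + \<epsilon>) * (LINT \<omega>'|M. (SUP j\<in>I. norm (empirical_cf X n (u j) \<omega>' - cf M X n (u j)))) + x}
          \<le> 2 * exp (- real n * min (x\<^sup>2 / c\<^sub>1) (x / c\<^sub>2))))"

end

theory Submission
  imports Defs "HOL-Real_Asymp.Real_Asymp"
begin

text \<open>
  The deviation probability decays faster than every power of \<open>n\<close>, so the particular exponent is
  immaterial. For bounded \<open>U\<close> the increments over time \<open>1/n\<close> tend to 0 in probability, hence the
  variance of \<open>exp (iU\<Delta>X)\<close> tends to 0 and Bernstein's inequality at scale \<open>sqrt (log n / n)\<close> gives
  any power. For \<open>|U| \<ge> R\<close> the squared threshold carries the factor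
  \<open>log (e + |U|) ^ (1 + 2\<delta>) \<ge> log (e + |U|) * log (e + R) ^ (2\<delta>)\<close>; choosing \<open>R\<close> large gives any
  power of \<open>n\<close> and, because \<open>\<delta> > 0\<close>, an additional \<open>(e + |U|) ^ (-2)\<close>, which makes the union bound
  over the infinite grid \<open>U = m/n\<close> summable. No truncation in \<open>U\<close> is needed.

  Passing from the grid to all \<open>U\<close> requires no moments either: cadlag paths are bounded on \<open>[0, 1]\<close>,
  so for some \<open>r\<close> no increment exceeds \<open>r\<close> with probability at least 1/2, and by independence each
  of the \<open>n\<close> increments exceeds \<open>r\<close> with probability at most \<open>1/n\<close>. The number of large increments
  again satisfies Bernstein's inequality with small variance, and the remaining ones vary slowly
  between grid points.
\<close>

section \<open>Bernstein's inequality\<close>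

text \<open>For negative \<open>x = - y\<close>, the product of \<open>1 - y + y\<^sup>2\<close>
  with the Taylor polynomial \<open>1 + y + y\<^sup>2 / 2\<close> is at least 1, and that polynomial
  lies below \<open>exp y\<close>; dividing by \<open>exp y\<close> gives the bound.\<close>

lemma exp_le_quadratic:
  fixes x :: real
  assumes "\<bar>x\<bar> \<le> 1"
  shows "exp x \<le> 1 + x + x\<^sup>2"
proof (cases "0 \<le> x")
  case True
  then show ?thesis using exp_bound assms by simp
next
  case False
  define y where "y = - x"
  have y: "0 \<le> y" "y \<le> 1" using False assms by (auto simp: y_def)
  have "(1 - y + y\<^sup>2) * (1 + y + y\<^sup>2 / 2) = 1 + (y\<^sup>2 + y ^ 3 + y ^ 4) / 2"
    by (simp add: field_simps power2_eq_square power3_eq_cube power4_eq_xxxx)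
  then have "1 \<le> (1 - y + y\<^sup>2) * (1 + y + y\<^sup>2 / 2)" using y by simp
  also have "\<dots> \<le> (1 - y + y\<^sup>2) * exp y"
    using y exp_lower_Taylor_quadratic[of y] by (intro mult_left_mono) auto
  finally have "exp (- y) \<le> 1 - y + y\<^sup>2" by (simp add: exp_minus field_simps)
  then show ?thesis by (simp add: y_def)
qed

text \<open>Chernoff's method: \<open>l \<le> 1/4\<close> keeps
  \<open>l * (Y i \<omega> - \<mu>)\<close> within [-1, 1], so the quadratic bound makes each
  exponential moment at most \<open>exp (l\<^sup>2 * v)\<close>. The parameter \<open>l\<close>
  stays free because each application balances it against a different \<open>v\<close>; the bound 2
  accommodates \<open>cos x - 1\<close>.\<close>

lemma (in prob_space) bernstein_upper:
  fixes Y :: "nat \<Rightarrow> 'a \<Rightarrow> real"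
  assumes indep: "indep_vars (\<lambda>_. borel) Y {..<n}"
    and bounded: "\<And>i \<omega>. i < n \<Longrightarrow> \<bar>Y i \<omega>\<bar> \<le> 2"
    and mean: "\<And>i. i < n \<Longrightarrow> expectation (Y i) = \<mu>"
    and second_moment: "\<And>i. i < n \<Longrightarrow> expectation (\<lambda>\<omega>. (Y i \<omega>)\<^sup>2) \<le> v"
    and l: "0 < l" "l \<le> 1/4"
  shows "prob {\<omega> \<in> space M. real n * s \<le> (\<Sum>i<n. Y i \<omega> - \<mu>)}
      \<le> exp (- l * real n * s + real n * l\<^sup>2 * v)"
proof -
  have rv [measurable]: "Y i \<in> borel_measurable M" if "i < n" for i
    using indep that by (auto simp: indep_vars_def)
  have int: "integrable M (Y i)" "integrable M (\<lambda>\<omega>. (Y i \<omega>)\<^sup>2)" if "i < n" for i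
    using rv[OF that] bounded[OF that] power_mono[OF bounded[OF that] abs_ge_zero, where n=2]
    by (intro integrable_const_bound[where B=2] integrable_const_bound[where B=4]; simp)+
  have mu: "\<bar>\<mu>\<bar> \<le> 2" if "i < n" for i
  proof -
    have "\<bar>expectation (Y i)\<bar> \<le> expectation (\<lambda>\<omega>. \<bar>Y i \<omega>\<bar>)" by (rule integral_abs_bound)
    also have "\<dots> \<le> expectation (\<lambda>\<omega>. 2)"
      using int[OF that] bounded[OF that] by (intro integral_mono) auto
    finally show ?thesis using mean[OF that] by (simp add: prob_space)
  qed
  have bd: "\<bar>l * (Y i \<omega> - \<mu>)\<bar> \<le> 1" if "i < n" for i \<omega>
  proof -
    have "\<bar>Y i \<omega> - \<mu>\<bar> \<le> 4" using bounded[OF that, of \<omega>] mu[OF that] by linarith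
    then have "l * \<bar>Y i \<omega> - \<mu>\<bar> \<le> (1/4) * 4" using l by (intro mult_mono) auto
    then show ?thesis using l by (simp add: abs_mult)
  qed
  have int_exp: "integrable M (\<lambda>\<omega>. exp (l * (Y i \<omega> - \<mu>)))" if "i < n" for i
    using rv[OF that] bd[OF that] by (intro integrable_const_bound[where B="exp 1"]) (auto simp: abs_le_iff)
  have indep_exp: "indep_vars (\<lambda>_. borel) (\<lambda>i \<omega>. exp (l * (Y i \<omega> - \<mu>))) {..<n}"
    by (rule indep_vars_compose2[OF indep]) auto
  have mgf: "expectation (\<lambda>\<omega>. exp (l * (Y i \<omega> - \<mu>))) \<le> exp (l\<^sup>2 * v)" if i: "i < n" for i
  proof -
    have "expectation (\<lambda>\<omega>. exp (l * (Y i \<omega> - \<mu>)))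
        \<le> expectation (\<lambda>\<omega>. 1 + l * (Y i \<omega> - \<mu>) + l\<^sup>2 * ((Y i \<omega>)\<^sup>2 - 2 * \<mu> * Y i \<omega> + \<mu>\<^sup>2))"
    proof (rule integral_mono)
      fix \<omega>
      show "exp (l * (Y i \<omega> - \<mu>)) \<le> 1 + l * (Y i \<omega> - \<mu>) + l\<^sup>2 * ((Y i \<omega>)\<^sup>2 - 2 * \<mu> * Y i \<omega> + \<mu>\<^sup>2)"
        using exp_le_quadratic[OF bd[OF i, of \<omega>]] by (simp add: power2_eq_square algebra_simps)
    qed (use int[OF i] int_exp[OF i] in auto)
    also have "\<dots> = 1 + l\<^sup>2 * (expectation (\<lambda>\<omega>. (Y i \<omega>)\<^sup>2) - \<mu>\<^sup>2)"
      using int[OF i] by (simp add: prob_space mean[OF i] power2_eq_square algebra_simps)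
    also have "\<dots> \<le> 1 + l\<^sup>2 * v"
    proof -
      have "expectation (\<lambda>\<omega>. (Y i \<omega>)\<^sup>2) - \<mu>\<^sup>2 \<le> v"
        using second_moment[OF i] zero_le_power2[of \<mu>] by linarith
      then show ?thesis by (simp add: mult_left_mono)
    qed
    also have "\<dots> \<le> exp (l\<^sup>2 * v)" by simp
    finally show ?thesis .
  qed
  have prod: "exp (l * (\<Sum>i<n. Y i \<omega> - \<mu>)) = (\<Prod>i<n. exp (l * (Y i \<omega> - \<mu>)))" for \<omega>
    by (simp add: exp_sum sum_distrib_left)
  have int_prod: "integrable M (\<lambda>\<omega>. exp (l * (\<Sum>i<n. Y i \<omega> - \<mu>)))"
    unfolding prod using indep_exp int_exp by (intro indep_vars_integrable) auto
  have "prob {\<omega> \<in> space M. real n * s \<le> (\<Sum>i<n. Y i \<omega> - \<mu>)}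
      \<le> exp (- l * (real n * s)) * (\<integral>\<omega>\<in>space M. exp (l * (\<Sum>i<n. Y i \<omega> - \<mu>)) \<partial>M)"
    using l int_prod by (intro Chernoff_ineq_ge) (auto simp: set_integrable_def cong: Bochner_Integration.integrable_cong)
  also have "(\<integral>\<omega>\<in>space M. exp (l * (\<Sum>i<n. Y i \<omega> - \<mu>)) \<partial>M)
      = expectation (\<lambda>\<omega>. \<Prod>i<n. exp (l * (Y i \<omega> - \<mu>)))"
    unfolding prod[symmetric] set_lebesgue_integral_def by (intro Bochner_Integration.integral_cong) auto
  also have "\<dots> = (\<Prod>i<n. expectation (\<lambda>\<omega>. exp (l * (Y i \<omega> - \<mu>))))"
    using indep_exp int_exp by (intro indep_vars_lebesgue_integral) auto
  also have "\<dots> \<le> (\<Prod>i<n. exp (l\<^sup>2 * v))" using mgf by (intro prod_mono) auto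
  also have "\<dots> = exp (real n * l\<^sup>2 * v)" by (simp add: exp_of_nat_mult[symmetric] mult.assoc)
  finally show ?thesis by (simp add: exp_add[symmetric] mult.assoc)
qed

lemma (in prob_space) bernstein_abs:
  fixes Y :: "nat \<Rightarrow> 'a \<Rightarrow> real"
  assumes indep: "indep_vars (\<lambda>_. borel) Y {..<n}"
    and bounded: "\<And>i \<omega>. i < n \<Longrightarrow> \<bar>Y i \<omega>\<bar> \<le> 2"
    and mean: "\<And>i. i < n \<Longrightarrow> expectation (Y i) = \<mu>"
    and second_moment: "\<And>i. i < n \<Longrightarrow> expectation (\<lambda>\<omega>. (Y i \<omega>)\<^sup>2) \<le> v"
    and l: "0 < l" "l \<le> 1/4"
  shows "prob {\<omega> \<in> space M. real n * s \<le> \<bar>\<Sum>i<n. Y i \<omega> - \<mu>\<bar>}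
      \<le> 2 * exp (- l * real n * s + real n * l\<^sup>2 * v)"
proof -
  have rv [measurable]: "Y i \<in> borel_measurable M" if "i < n" for i
    using indep that by (auto simp: indep_vars_def)
  let ?A = "{\<omega> \<in> space M. real n * s \<le> (\<Sum>i<n. Y i \<omega> - \<mu>)}"
  let ?B = "{\<omega> \<in> space M. real n * s \<le> (\<Sum>i<n. - Y i \<omega> - - \<mu>)}"
  have "(\<Sum>i<n. - Y i \<omega> - - \<mu>) = - (\<Sum>i<n. Y i \<omega> - \<mu>)" for \<omega>
    by (simp add: sum_negf[symmetric])
  then have sub: "{\<omega> \<in> space M. real n * s \<le> \<bar>\<Sum>i<n. Y i \<omega> - \<mu>\<bar>} \<subseteq> ?A \<union> ?B"
    by auto
  have "(\<lambda>\<omega>. \<Sum>i<n. Y i \<omega> - \<mu>) \<in> borel_measurable M" "(\<lambda>\<omega>. \<Sum>i<n. - Y i \<omega> - - \<mu>) \<in> borel_measurable M"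
    by (intro borel_measurable_sum; simp)+
  then have sets: "?A \<in> sets M" "?B \<in> sets M" by measurable
  have "prob {\<omega> \<in> space M. real n * s \<le> \<bar>\<Sum>i<n. Y i \<omega> - \<mu>\<bar>} \<le> prob ?A + prob ?B"
    using finite_measure_mono[OF sub sets.Un[OF sets]] measure_Un_le[OF sets] by linarith
  also have "prob ?A \<le> exp (- l * real n * s + real n * l\<^sup>2 * v)"
    using assms by (rule bernstein_upper)
  also have "prob ?B \<le> exp (- l * real n * s + real n * l\<^sup>2 * v)"
    using assms by (intro bernstein_upper indep_vars_compose2[OF indep]) auto
  finally show ?thesis by simp
qed

section \<open>Boundedness of cadlag functions and oscillation of characters\<close>

lemma locally_bounded_imp_bounded_on_compact:
  fixes f :: "'a::topological_space \<Rightarrow> 'b::real_normed_vector"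
  assumes "compact K"
    and loc: "\<And>x. x \<in> K \<Longrightarrow> \<exists>B. \<forall>\<^sub>F y in at x within K. norm (f y) \<le> B"
  shows "\<exists>B. \<forall>x\<in>K. norm (f x) \<le> B"
proof -
  have "\<exists>U B. open U \<and> x \<in> U \<and> (\<forall>y\<in>U \<inter> K. norm (f y) \<le> B)" if x: "x \<in> K" for x
  proof -
    obtain B where "\<forall>\<^sub>F y in at x within K. norm (f y) \<le> B" using loc[OF x] by blast
    then obtain U where "open U" "x \<in> U" "\<forall>y\<in>U. y \<noteq> x \<longrightarrow> y \<in> K \<longrightarrow> norm (f y) \<le> B"
      unfolding eventually_at_topological by blast
    \<comment> \<open>The filter \<open>at x within K\<close> leaves out \<open>x\<close> itself, so
      the value there enters through the maximum.\<close>
    then have "open U \<and> x \<in> U \<and> (\<forall>y\<in>U \<inter> K. norm (f y) \<le> max B (norm (f x)))"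
      by (metis IntE le_max_iff_disj order_refl)
    then show ?thesis by blast
  qed
  then obtain U B where U: "\<And>x. x \<in> K \<Longrightarrow> open (U x)" "\<And>x. x \<in> K \<Longrightarrow> x \<in> U x"
    and B: "\<And>x y. x \<in> K \<Longrightarrow> y \<in> U x \<inter> K \<Longrightarrow> norm (f y) \<le> B x"
    by metis
  obtain C where C: "C \<subseteq> K" "finite C" "K \<subseteq> (\<Union>c\<in>C. U c)"
    using compactE_image[OF \<open>compact K\<close>, of K U] U by blast
  have "norm (f x) \<le> Max (B ` C)" if x: "x \<in> K" for x
  proof -
    obtain c where c: "c \<in> C" "x \<in> U c" using C x by blast
    then have "norm (f x) \<le> B c" using B C x by blast
    also have "\<dots> \<le> Max (B ` C)" using C c by auto
    finally show ?thesis .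
  qed
  then show ?thesis by blast
qed

lemma norm_iexp_diff_le: "norm (iexp x - iexp y) \<le> \<bar>x - y\<bar>"
proof -
  have "iexp x - iexp y = iexp y * (iexp (x - y) - 1)"
    by (simp add: algebra_simps flip: exp_add)
  then have "norm (iexp x - iexp y) = norm (iexp (x - y) - 1)" by (simp add: norm_mult)
  also have "\<dots> \<le> \<bar>x - y\<bar>" using iexp_approx1[of "x - y" 0] by simp
  finally show ?thesis .
qed

lemma norm_iexp_minus_one_sq_le: "(norm (iexp x - 1))\<^sup>2 \<le> 4"
proof -
  have "norm (iexp x - 1) \<le> 2" using norm_triangle_ineq4[of "iexp x" 1] by simp
  then show ?thesis using power_mono[of "norm (iexp x - 1)" 2 2] by simp
qed

lemma tendsto_norm_imp_eventually_le:
  fixes f :: "'a \<Rightarrow> 'b::real_normed_vector"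
  assumes "(f \<longlongrightarrow> l) F"
  shows "\<forall>\<^sub>F x in F. norm (f x) \<le> norm l + 1"
  using order_tendstoD(2)[OF tendsto_norm[OF assms], of "norm l + 1"]
  by (auto elim: eventually_mono)

text \<open>One-sided limits bound \<open>f\<close> near each point, and compactness of the interval
  turns the local bounds into a global one.\<close>

lemma cadlag_bounded_on_Icc:
  fixes f :: "real \<Rightarrow> 'b::real_normed_vector"
  assumes right: "\<And>t. 0 \<le> t \<Longrightarrow> (f \<longlongrightarrow> f t) (at_right t)"
    and left: "\<And>t. 0 < t \<Longrightarrow> \<exists>l. (f \<longlongrightarrow> l) (at_left t)"
  shows "\<exists>B. \<forall>t\<in>{0..T}. norm (f t) \<le> B"
proof (rule locally_bounded_imp_bounded_on_compact)
  fix t assume t: "t \<in> {0..T}"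
  have r: "\<forall>\<^sub>F s in at_right t. norm (f s) \<le> norm (f t) + 1"
    using t by (intro tendsto_norm_imp_eventually_le right) auto
  show "\<exists>B. \<forall>\<^sub>F s in at t within {0..T}. norm (f s) \<le> B"
  \<comment> \<open>At 0 the right limit suffices, since \<open>{0..T}\<close> has no points to the
    left of 0.\<close>
  proof (cases "t = 0")
    case True
    then have "\<forall>\<^sub>F s in at t within {0..T}. norm (f s) \<le> norm (f t) + 1"
      using r True unfolding eventually_at_filter by (auto elim!: eventually_mono)
    then show ?thesis by blast
  next
    case False
    then obtain l where "(f \<longlongrightarrow> l) (at_left t)" using left t by fastforce
    then have "\<forall>\<^sub>F s in at_left t. norm (f s) \<le> norm l + 1"
      by (rule tendsto_norm_imp_eventually_le)
    with r have "\<forall>\<^sub>F s in at t. norm (f s) \<le> max (norm (f t) + 1) (norm l + 1)"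
      unfolding eventually_at_split by (auto simp: le_max_iff_disj elim: eventually_mono)
    then show ?thesis using at_le[of "{0..T}" UNIV t] filter_leD by blast
  qed
qed simp

section \<open>Empirical characteristic functions of triangular arrays\<close>

lemma inverse_weight: "inverse (weight \<delta> U) = ln (exp 1 + \<bar>U\<bar>) powr (1 / 2 + \<delta>)"
  unfolding weight_def by (simp add: powr_minus[symmetric] add.commute)

lemma ln_exp1_plus_ge_1: "1 \<le> ln (exp 1 + \<bar>U\<bar> :: real)"
  using ln_mono[of "exp 1" "exp 1 + \<bar>U\<bar>"] by (simp add: add_pos_nonneg)

lemma inverse_weight_ge_1: "0 \<le> \<delta> \<Longrightarrow> 1 \<le> inverse (weight \<delta> U)"
  unfolding inverse_weight using ln_exp1_plus_ge_1 by (intro ge_one_powr_ge_zero) auto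

lemma inverse_weight_mono:
  assumes "0 \<le> \<delta>" "\<bar>U\<bar> \<le> \<bar>V\<bar>"
  shows "inverse (weight \<delta> U) \<le> inverse (weight \<delta> V)"
proof -
  have "ln (exp 1 + \<bar>U\<bar>) \<le> ln (exp 1 + \<bar>V\<bar>)" using assms by (intro ln_mono) (auto intro: add_pos_nonneg)
  then show ?thesis unfolding inverse_weight
    using assms ln_exp1_plus_ge_1[of U] by (intro powr_mono2) auto
qed

text \<open>Of the exponent \<open>1 + 2 * \<delta>\<close>, the power 1 later yields polynomial
  decay in \<open>\<bar>U\<bar>\<close>, and the power \<open>2 * \<delta>\<close> an arbitrarily
  large constant in front of it.\<close>

lemma inverse_weight_sq:
  "(inverse (weight \<delta> U))\<^sup>2 = ln (exp 1 + \<bar>U\<bar>) * ln (exp 1 + \<bar>U\<bar>) powr (2 * \<delta>)"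
proof -
  let ?l = "ln (exp 1 + \<bar>U\<bar>)"
  have "(inverse (weight \<delta> U))\<^sup>2 = ?l powr (1 + 2 * \<delta>)"
    unfolding inverse_weight power2_eq_square by (simp add: powr_add[symmetric])
  also have "\<dots> = ?l powr 1 * ?l powr (2 * \<delta>)" by (rule powr_add)
  also have "?l powr 1 = ?l" using ln_exp1_plus_ge_1[of U] by (intro powr_one) linarith
  finally show ?thesis .
qed

definition rate :: "nat \<Rightarrow> real" where
  "rate n = sqrt (ln (real n) / real n)"

lemma rate_sq: "1 \<le> n \<Longrightarrow> real n * (rate n)\<^sup>2 = ln (real n)"
  by (simp add: rate_def)

lemma rate_pos: "2 \<le> n \<Longrightarrow> 0 < rate n"
  by (simp add: rate_def)

lemma rate_tendsto_0: "rate \<longlonglongrightarrow> 0"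
  unfolding rate_def by real_asymp

text \<open>Interpolation errors of order \<open>1 / n\<close> are thereby absorbed into a fraction
  of the threshold.\<close>

lemma eventually_rate_ge:
  assumes "0 < c"
  shows "\<forall>\<^sub>F n in sequentially. C / real n \<le> c * rate n"
proof -
  have "(\<lambda>n. C / (real n * rate n)) \<longlonglongrightarrow> 0" unfolding rate_def by real_asymp
  then have "\<forall>\<^sub>F n in sequentially. C / (real n * rate n) < c" using assms by (rule order_tendstoD)
  then show ?thesis using eventually_ge_at_top[of 2]
  proof eventually_elim
    case (elim n)
    then show ?case using rate_pos[of n] by (simp add: field_simps)
  qed
qed

lemma ln_ge_1: "3 \<le> n \<Longrightarrow> 1 \<le> ln (real n)"
  using exp_le by (subst ln_ge_iff) auto

text \<open>
  The condition \<open>prob_large\<close> stands in for a moment assumption: entries beyond \<open>r\<close> occur at most once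
  per row on average.
\<close>

locale null_array = prob_space M
  for M :: "'a measure" and Z :: "nat \<Rightarrow> nat \<Rightarrow> 'a \<Rightarrow> real" and r :: real +
  assumes indep: "1 \<le> n \<Longrightarrow> indep_vars (\<lambda>_. borel) (Z n) {..<n}"
    and identically_distributed: "i < n \<Longrightarrow> distr M borel (Z n i) = distr M borel (Z n 0)"
    and prob_large: "1 \<le> n \<Longrightarrow> real n * prob {\<omega> \<in> space M. r < \<bar>Z n 0 \<omega>\<bar>} \<le> 1"
    and tendsto_null: "0 < \<eta> \<Longrightarrow> (\<lambda>n. prob {\<omega> \<in> space M. \<eta> < \<bar>Z n 0 \<omega>\<bar>}) \<longlonglongrightarrow> 0"
    and r_nonneg: "0 \<le> r"
begin

lemma rv: "i < n \<Longrightarrow> Z n i \<in> borel_measurable M"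
  using indep[of n] by (cases n) (auto simp: indep_vars_def)

lemma expectation_ident:
  fixes f :: "real \<Rightarrow> 'b::{banach, second_countable_topology}"
  assumes "i < n" and [measurable]: "f \<in> borel_measurable borel"
  shows "expectation (\<lambda>\<omega>. f (Z n i \<omega>)) = expectation (\<lambda>\<omega>. f (Z n 0 \<omega>))"
proof -
  have [measurable]: "Z n i \<in> borel_measurable M" "Z n 0 \<in> borel_measurable M"
    using rv assms by auto
  have "expectation (\<lambda>\<omega>. f (Z n i \<omega>)) = integral\<^sup>L (distr M borel (Z n i)) f"
    by (simp add: integral_distr)
  also have "\<dots> = expectation (\<lambda>\<omega>. f (Z n 0 \<omega>))"
    unfolding identically_distributed[OF assms(1)] by (simp add: integral_distr)
  finally show ?thesis .
qed

lemma measurable_sum_comp: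
  fixes f :: "real \<Rightarrow> 'b::{second_countable_topology, real_normed_vector}"
  assumes "f \<in> borel_measurable borel"
  shows "(\<lambda>\<omega>. \<Sum>i<n. f (Z n i \<omega>)) \<in> borel_measurable M"
  using measurable_compose[OF rv assms] by (intro borel_measurable_sum) simp

section \<open>Deviation of the empirical characteristic function at a fixed frequency\<close>

definition dev :: "nat \<Rightarrow> real \<Rightarrow> 'a \<Rightarrow> real" where
  "dev n U \<omega> = norm ((1 / of_nat n) * (\<Sum>i<n. iexp (U * Z n i \<omega>))
     - expectation (\<lambda>\<omega>. iexp (U * Z n 0 \<omega>)))"

lemma measurable_dev [measurable]: "dev n U \<in> borel_measurable M"
proof -
  have "(\<lambda>\<omega>. \<Sum>i<n. iexp (U * Z n i \<omega>)) \<in> borel_measurable M"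
    by (rule measurable_sum_comp) measurable
  then show ?thesis unfolding dev_def by measurable
qed

lemma iexp_integrable: "1 \<le> n \<Longrightarrow> integrable M (\<lambda>\<omega>. iexp (U * Z n 0 \<omega>))"
  using rv[of 0 n] by (intro integrable_const_bound[where B=1]) auto

lemma norm_iexp_minus_one_sq_integrable:
  assumes "1 \<le> n"
  shows "integrable M (\<lambda>\<omega>. (norm (iexp (U * Z n 0 \<omega>) - 1))\<^sup>2)"
proof (rule integrable_const_bound[where B=4])
  have [measurable]: "Z n 0 \<in> borel_measurable M" using rv assms by auto
  show "(\<lambda>\<omega>. (norm (iexp (U * Z n 0 \<omega>) - 1))\<^sup>2) \<in> borel_measurable M" by measurable
  show "AE \<omega> in M. norm ((norm (iexp (U * Z n 0 \<omega>) - 1))\<^sup>2) \<le> 4"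
    unfolding real_norm_def abs_of_nonneg[OF zero_le_power2] using norm_iexp_minus_one_sq_le by blast
qed

lemma dev_le_2:
  assumes "1 \<le> n"
  shows "dev n U \<omega> \<le> 2"
proof -
  have "norm (\<Sum>i<n. iexp (U * Z n i \<omega>)) \<le> (\<Sum>i<n. 1)" by (intro sum_norm_le) simp
  then have "norm ((1 / of_nat n) * (\<Sum>i<n. iexp (U * Z n i \<omega>))) \<le> 1"
    using assms by (simp add: norm_mult norm_divide field_simps)
  moreover have "norm (expectation (\<lambda>\<omega>. iexp (U * Z n 0 \<omega>))) \<le> 1"
    using integral_norm_bound[of M "\<lambda>\<omega>. iexp (U * Z n 0 \<omega>)"] by (simp add: prob_space)
  ultimately show ?thesis
    unfolding dev_def by (smt (verit) norm_triangle_ineq4)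
qed

text \<open>A deviation of size \<open>s\<close> forces the real or the imaginary part to deviate by
  \<open>s / 2\<close>, and each part is a centred average to which the two-sided Bernstein bound
  applies.\<close>

lemma dev_tail:
  assumes n: "1 \<le> n"
    and v: "expectation (\<lambda>\<omega>. (norm (iexp (U * Z n 0 \<omega>) - 1))\<^sup>2) \<le> v"
    and l: "0 < l" "l \<le> 1/4"
  shows "prob {\<omega> \<in> space M. s \<le> dev n U \<omega>}
    \<le> 4 * exp (- l * real n * (s / 2) + real n * l\<^sup>2 * v)"
proof -
  have [measurable]: "Z n 0 \<in> borel_measurable M" using rv n by auto
  \<comment> \<open>The cosine is shifted by 1: the second moments of \<open>cos - 1\<close> and
    \<open>sin\<close> add up to that of \<open>norm (iexp - 1)\<close>, which is small when the
    entries are small, whereas that of \<open>cos\<close> is then close to 1. Centring cancels the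
    shift.\<close>
  define p where "p = expectation (\<lambda>\<omega>. cos (U * Z n 0 \<omega>) - 1)"
  define q where "q = expectation (\<lambda>\<omega>. sin (U * Z n 0 \<omega>))"
  have chf: "expectation (\<lambda>\<omega>. iexp (U * Z n 0 \<omega>)) = Complex (1 + p) q"
  proof (rule complex_eqI)
    have i: "integrable M (\<lambda>\<omega>. cos (U * Z n 0 \<omega>))"
      by (intro integrable_const_bound[where B=1]) auto
    show "Re (expectation (\<lambda>\<omega>. iexp (U * Z n 0 \<omega>))) = Re (Complex (1 + p) q)"
      using iexp_integrable[OF n, of U] i by (simp add: integral_Re[symmetric] p_def prob_space Re_exp)
    show "Im (expectation (\<lambda>\<omega>. iexp (U * Z n 0 \<omega>))) = Im (Complex (1 + p) q)"
      using iexp_integrable[OF n, of U] by (simp add: integral_Im[symmetric] q_def Im_exp)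
  qed
  let ?A = "{\<omega> \<in> space M. real n * (s / 2) \<le> \<bar>\<Sum>i<n. (cos (U * Z n i \<omega>) - 1) - p\<bar>}"
  let ?B = "{\<omega> \<in> space M. real n * (s / 2) \<le> \<bar>\<Sum>i<n. sin (U * Z n i \<omega>) - q\<bar>}"
  have sq: "(norm (iexp x - 1))\<^sup>2 = (cos x - 1)\<^sup>2 + (sin x)\<^sup>2" for x :: real
    by (simp add: cmod_power2 Re_exp Im_exp)
  have int: "integrable M (\<lambda>\<omega>. (norm (iexp (U * Z n 0 \<omega>) - 1))\<^sup>2)"
    "integrable M (\<lambda>\<omega>. (cos (U * Z n 0 \<omega>) - 1)\<^sup>2)"
    "integrable M (\<lambda>\<omega>. (sin (U * Z n 0 \<omega>))\<^sup>2)"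
  proof -
    have "(cos x - 1)\<^sup>2 \<le> 4" "(sin x)\<^sup>2 \<le> 4" for x :: real
      using sq[of x] norm_iexp_minus_one_sq_le[of x]
        zero_le_power2[of "cos x - 1"] zero_le_power2[of "sin x"] by linarith+
    then show "integrable M (\<lambda>\<omega>. (cos (U * Z n 0 \<omega>) - 1)\<^sup>2)"
      "integrable M (\<lambda>\<omega>. (sin (U * Z n 0 \<omega>))\<^sup>2)"
      by (intro integrable_const_bound[where B=4]; simp)+
  qed (rule norm_iexp_minus_one_sq_integrable[OF n])
  have second: "expectation (\<lambda>\<omega>. (cos (U * Z n 0 \<omega>) - 1)\<^sup>2) \<le> v"
      "expectation (\<lambda>\<omega>. (sin (U * Z n 0 \<omega>))\<^sup>2) \<le> v"
    using int by (intro order_trans[OF integral_mono v]; simp only: sq le_add_same_cancel1 le_add_same_cancel2 zero_le_power2)+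
  have ind: "indep_vars (\<lambda>_. borel) (\<lambda>i \<omega>. f (Z n i \<omega>)) {..<n}"
    if "f \<in> borel_measurable borel" for f :: "real \<Rightarrow> real"
    using indep_vars_compose2[OF indep[OF n]] that by auto
  have "prob ?A \<le> 2 * exp (- l * real n * (s / 2) + real n * l\<^sup>2 * v)"
  proof (rule bernstein_abs[OF _ _ _ _ l])
    show "indep_vars (\<lambda>_. borel) (\<lambda>i \<omega>. cos (U * Z n i \<omega>) - 1) {..<n}"
      by (rule ind) measurable
    show "\<bar>cos (U * Z n i \<omega>) - 1\<bar> \<le> 2" for i \<omega>
      using cos_le_one[of "U * Z n i \<omega>"] cos_ge_minus_one[of "U * Z n i \<omega>"] by linarith
    show "expectation (\<lambda>\<omega>. cos (U * Z n i \<omega>) - 1) = p" if "i < n" for i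
      unfolding p_def using that by (rule expectation_ident) measurable
    show "expectation (\<lambda>\<omega>. (cos (U * Z n i \<omega>) - 1)\<^sup>2) \<le> v" if "i < n" for i
      using expectation_ident[OF that, of "\<lambda>x. (cos (U * x) - 1)\<^sup>2"] second by simp
  qed
  moreover have "prob ?B \<le> 2 * exp (- l * real n * (s / 2) + real n * l\<^sup>2 * v)"
  proof (rule bernstein_abs[OF _ _ _ _ l])
    show "indep_vars (\<lambda>_. borel) (\<lambda>i \<omega>. sin (U * Z n i \<omega>)) {..<n}"
      by (rule ind) measurable
    show "\<bar>sin (U * Z n i \<omega>)\<bar> \<le> 2" for i \<omega>
      using abs_sin_le_one[of "U * Z n i \<omega>"] by linarith
    show "expectation (\<lambda>\<omega>. sin (U * Z n i \<omega>)) = q" if "i < n" for i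
      unfolding q_def using that by (rule expectation_ident) measurable
    show "expectation (\<lambda>\<omega>. (sin (U * Z n i \<omega>))\<^sup>2) \<le> v" if "i < n" for i
      using expectation_ident[OF that, of "\<lambda>x. (sin (U * x))\<^sup>2"] second by simp
  qed
  moreover have "{\<omega> \<in> space M. s \<le> dev n U \<omega>} \<subseteq> ?A \<union> ?B"
  proof
    fix \<omega> assume \<omega>: "\<omega> \<in> {\<omega> \<in> space M. s \<le> dev n U \<omega>}"
    let ?z = "(1 / of_nat n) * (\<Sum>i<n. iexp (U * Z n i \<omega>)) - Complex (1 + p) q"
    have "s \<le> norm ?z" using \<omega> by (simp only: dev_def chf mem_Collect_eq)
    also have "\<dots> \<le> \<bar>Re ?z\<bar> + \<bar>Im ?z\<bar>" by (rule cmod_le)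
    finally have "real n * s \<le> real n * (\<bar>Re ?z\<bar> + \<bar>Im ?z\<bar>)" by (rule mult_left_mono) simp
    then have "real n * s \<le> \<bar>real n * Re ?z\<bar> + \<bar>real n * Im ?z\<bar>"
      by (simp only: distrib_left abs_mult abs_of_nat)
    moreover have "real n * Re ?z = (\<Sum>i<n. (cos (U * Z n i \<omega>) - 1) - p)"
      using n by (simp add: sum_subtractf Re_exp Re_divide_of_nat field_simps)
    moreover have "real n * Im ?z = (\<Sum>i<n. sin (U * Z n i \<omega>) - q)"
      using n by (simp add: sum_subtractf Im_exp Im_divide_of_nat field_simps)
    ultimately show "\<omega> \<in> ?A \<union> ?B" using \<omega> by auto
  qed
  moreover have "?A \<in> sets M" "?B \<in> sets M"
  proof -
    have "(\<lambda>\<omega>. \<Sum>i<n. (cos (U * Z n i \<omega>) - 1) - p) \<in> borel_measurable M"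
      "(\<lambda>\<omega>. \<Sum>i<n. sin (U * Z n i \<omega>) - q) \<in> borel_measurable M"
      by (rule measurable_sum_comp[of "\<lambda>x. cos (U * x) - 1 - p"]
          measurable_sum_comp[of "\<lambda>x. sin (U * x) - q"]; measurable)+
    then show "?A \<in> sets M" "?B \<in> sets M" by measurable
  qed
  ultimately show ?thesis
    using finite_measure_mono[of "{\<omega> \<in> space M. s \<le> dev n U \<omega>}" "?A \<union> ?B"]
      measure_Un_le[of ?A M ?B] by auto
qed

text \<open>Beyond \<open>\<eta>\<close> the integrand is at most 4; elsewhere
  \<open>norm (iexp x - 1) \<le> \<bar>x\<bar>\<close> applies.\<close>

lemma second_moment_le:
  assumes n: "1 \<le> n" and "0 \<le> \<eta>"
  shows "expectation (\<lambda>\<omega>. (norm (iexp (U * Z n 0 \<omega>) - 1))\<^sup>2)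
    \<le> 4 * prob {\<omega> \<in> space M. \<eta> < \<bar>Z n 0 \<omega>\<bar>} + (\<bar>U\<bar> * \<eta>)\<^sup>2"
proof -
  have [measurable]: "Z n 0 \<in> borel_measurable M" using rv n by auto
  let ?A = "{\<omega> \<in> space M. \<eta> < \<bar>Z n 0 \<omega>\<bar>}"
  have A: "?A \<in> sets M" by measurable
  have "expectation (\<lambda>\<omega>. (norm (iexp (U * Z n 0 \<omega>) - 1))\<^sup>2)
      \<le> expectation (\<lambda>\<omega>. 4 * indicator ?A \<omega> + (\<bar>U\<bar> * \<eta>)\<^sup>2)"
  proof (rule integral_mono)
    show "integrable M (\<lambda>\<omega>. (norm (iexp (U * Z n 0 \<omega>) - 1))\<^sup>2)"
      by (rule norm_iexp_minus_one_sq_integrable[OF n])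
    show "integrable M (\<lambda>\<omega>. 4 * indicator ?A \<omega> + (\<bar>U\<bar> * \<eta>)\<^sup>2 :: real)"
      using A by (intro Bochner_Integration.integrable_add integrable_mult_right) (auto simp: emeasure_eq_measure)
    fix \<omega> assume \<omega>: "\<omega> \<in> space M"
    show "(norm (iexp (U * Z n 0 \<omega>) - 1))\<^sup>2 \<le> 4 * indicator ?A \<omega> + (\<bar>U\<bar> * \<eta>)\<^sup>2"
    proof (cases "\<omega> \<in> ?A")
      case True
      then show ?thesis using norm_iexp_minus_one_sq_le[of "U * Z n 0 \<omega>"] by (simp add: add_increasing2)
    next
      case False
      have "norm (iexp (U * Z n 0 \<omega>) - 1) \<le> \<bar>U * Z n 0 \<omega>\<bar>"
        using norm_iexp_diff_le[of "U * Z n 0 \<omega>" 0] by simp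
      also have "\<dots> \<le> \<bar>U\<bar> * \<eta>" using False \<omega> by (auto simp: abs_mult intro!: mult_left_mono)
      finally have "(norm (iexp (U * Z n 0 \<omega>) - 1))\<^sup>2 \<le> (\<bar>U\<bar> * \<eta>)\<^sup>2"
        by (rule power_mono) simp
      then show ?thesis using False by simp
    qed
  qed
  also have "\<dots> = 4 * prob ?A + (\<bar>U\<bar> * \<eta>)\<^sup>2"
    using A by (simp add: prob_space emeasure_eq_measure)
  finally show ?thesis .
qed

text \<open>Changing the sign of \<open>U\<close> conjugates both characteristic functions. This
  reduces the union bound to a grid of nonnegative frequencies.\<close>

lemma dev_uminus: "dev n (- U) \<omega> = dev n U \<omega>"
proof -
  have c: "iexp (- U * z) = cnj (iexp (U * z))" for z by (simp add: exp_cnj)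
  have "dev n (- U) \<omega> = norm (cnj ((1 / of_nat n) * (\<Sum>i<n. iexp (U * Z n i \<omega>))
     - expectation (\<lambda>\<omega>. iexp (U * Z n 0 \<omega>))))"
    unfolding dev_def c integral_cnj by simp
  then show ?thesis unfolding dev_def complex_mod_cnj .
qed

text \<open>Only the trivial second moment bound 4 is used; the growth of the inverse weight
  supplies all of the decay.\<close>

lemma deviation_far:
  assumes n: "3 \<le> n" and "0 < t" "0 \<le> K"
    and K: "K + 4 \<le> t\<^sup>2 / 256 * ln (exp 1 + \<bar>U\<bar>) powr (2 * \<delta>)"
  shows "prob {\<omega> \<in> space M. t / 2 * rate n * inverse (weight \<delta> U) \<le> dev n U \<omega>}
    \<le> 4 * real n powr (- (K + 2)) / (exp 1 + \<bar>U\<bar>)\<^sup>2"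
proof -
  define s where "s = t / 2 * rate n * inverse (weight \<delta> U)"
  let ?l = "ln (exp 1 + \<bar>U\<bar>)"
  have s: "0 < s" unfolding s_def using rate_pos[of n] n \<open>0 < t\<close> ln_exp1_plus_ge_1[of U]
    by (simp add: inverse_weight)
  show ?thesis
  proof (cases "s \<le> 2")
    case False
    \<comment> \<open>The deviation never exceeds 2, so the event is empty.\<close>
    then have "{\<omega> \<in> space M. s \<le> dev n U \<omega>} = {}" using dev_le_2[of n U] n by (auto simp: not_le intro: le_less_trans)
    then have "prob {\<omega> \<in> space M. s \<le> dev n U \<omega>} = 0" by (simp only: measure_empty)
    then show ?thesis unfolding s_def[symmetric] by simp
  next
    case True
    have v: "expectation (\<lambda>\<omega>. (norm (iexp (U * Z n 0 \<omega>) - 1))\<^sup>2) \<le> 4"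
      using second_moment_le[of n 0 U] n
        order_trans[OF _ mult_left_mono[OF prob_le_1, of 4]] by force
    \<comment> \<open>The step \<open>s / 16\<close> minimises the exponent and is admissible since \<open>s \<le> 2\<close>.\<close>
    have "prob {\<omega> \<in> space M. s \<le> dev n U \<omega>}
        \<le> 4 * exp (- (s / 16) * real n * (s / 2) + real n * (s / 16)\<^sup>2 * 4)"
      using n s True by (intro dev_tail v) auto
    also have "- (s / 16) * real n * (s / 2) + real n * (s / 16)\<^sup>2 * 4 = - (real n * s\<^sup>2) / 64"
      by (simp add: power2_eq_square field_simps)
    also have "real n * s\<^sup>2 = t\<^sup>2 / 4 * (real n * (rate n)\<^sup>2) * (inverse (weight \<delta> U))\<^sup>2"
      unfolding s_def by (simp add: power_mult_distrib power_divide)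
    also have "\<dots> = 64 * (ln (real n) * ?l * (t\<^sup>2 / 256 * ?l powr (2 * \<delta>)))"
      using n by (simp add: rate_sq inverse_weight_sq)
    \<comment> \<open>The factor \<open>K + 4\<close> in front of the product of the two logarithms
      is split into \<open>K + 2\<close> and 2. As both logarithms are at least 1, which is where
      \<open>3 \<le> n\<close> enters, the product dominates each of them.\<close>
    also have "4 * exp (- (64 * (ln (real n) * ?l * (t\<^sup>2 / 256 * ?l powr (2 * \<delta>)))) / 64)
        \<le> 4 * exp (- ((K + 2) * ln (real n)) - 2 * ?l)"
    proof -
      have 1: "1 \<le> ln (real n)" "1 \<le> ?l" using ln_ge_1[OF n] ln_exp1_plus_ge_1 by auto
      have "(K + 2) * ln (real n) * 1 \<le> (K + 2) * ln (real n) * ?l"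
        using 1 \<open>0 \<le> K\<close> by (intro mult_left_mono) auto
      moreover have "2 * ?l * 1 \<le> 2 * ?l * ln (real n)"
        using 1 by (intro mult_left_mono) auto
      moreover have "ln (real n) * ?l * (K + 4) \<le> ln (real n) * ?l * (t\<^sup>2 / 256 * ?l powr (2 * \<delta>))"
        using 1 K by (intro mult_left_mono) auto
      ultimately show ?thesis by (simp add: algebra_simps)
    qed
    also have "exp (- ((K + 2) * ln (real n)) - 2 * ?l) = real n powr (- (K + 2)) / (exp 1 + \<bar>U\<bar>)\<^sup>2"
    proof -
      have "exp (2 * ?l) = (exp ?l)\<^sup>2" by (simp add: exp_double)
      also have "exp ?l = exp 1 + \<bar>U\<bar>" by (simp add: add_pos_nonneg)
      finally have "exp (2 * ?l) = (exp 1 + \<bar>U\<bar>)\<^sup>2" .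
      moreover have "exp (- ((K + 2) * ln (real n))) = real n powr (- (K + 2))"
        using n by (simp add: powr_def algebra_simps)
      ultimately show ?thesis by (simp only: exp_diff)
    qed
    finally show ?thesis unfolding s_def by simp
  qed
qed

text \<open>For bounded \<open>U\<close> the second moment falls below any constant, uniformly in
  \<open>U\<close>, so a step \<open>l = a * rate n\<close> with large \<open>a\<close> becomes
  affordable. The extra power \<open>n powr (-2)\<close> pays for the grid points in this
  range.\<close>

lemma deviation_near:
  assumes t: "0 < t" and "0 \<le> K" "0 \<le> \<delta>" "0 \<le> R"
  shows "\<forall>\<^sub>F n in sequentially. \<forall>U. \<bar>U\<bar> \<le> R \<longrightarrow>
    prob {\<omega> \<in> space M. t / 2 * rate n * inverse (weight \<delta> U) \<le> dev n U \<omega>}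
      \<le> 4 * real n powr (- (K + 2))"
proof -
  \<comment> \<open>This value solves \<open>1 - a * t / 4 = - (K + 2)\<close>, the coefficient of
    \<open>ln n\<close> in the final exponent.\<close>
  define a where "a = 4 * (K + 3) / t"
  have a: "0 < a" using assms by (simp add: a_def)
  \<comment> \<open>With this \<open>\<eta>\<close> the small entries contribute at most
    \<open>1 / (4 * a\<^sup>2)\<close> to the second moment; the large ones contribute at most
    \<open>1 / (2 * a\<^sup>2)\<close> once their probability is below
    \<open>1 / (8 * a\<^sup>2)\<close>.\<close>
  define \<eta> where "\<eta> = 1 / (2 * a * (R + 1))"
  have \<eta>: "0 < \<eta>" using a assms by (simp add: \<eta>_def)
  have "\<forall>\<^sub>F n in sequentially. prob {\<omega> \<in> space M. \<eta> < \<bar>Z n 0 \<omega>\<bar>} < 1 / (8 * a\<^sup>2)"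
    using order_tendstoD(2)[OF tendsto_null[OF \<eta>]] a by simp
  moreover have "\<forall>\<^sub>F n in sequentially. rate n < 1 / (4 * a)"
    using order_tendstoD(2)[OF rate_tendsto_0] a by simp
  ultimately show ?thesis using eventually_ge_at_top[of 3]
  proof eventually_elim
    case (elim n)
    show ?case
    proof (intro allI impI)
      fix U :: real assume U: "\<bar>U\<bar> \<le> R"
      have "\<bar>U\<bar> * \<eta> \<le> (R + 1) * \<eta>" using U \<eta> by (intro mult_right_mono) auto
      also have "\<dots> = 1 / (2 * a)" using assms a by (simp add: \<eta>_def)
      finally have "(\<bar>U\<bar> * \<eta>)\<^sup>2 \<le> (1 / (2 * a))\<^sup>2" using \<eta> by (intro power_mono) auto
      also have "\<dots> = 1 / (4 * a\<^sup>2)" by (simp add: power_divide)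
      finally have "4 * prob {\<omega> \<in> space M. \<eta> < \<bar>Z n 0 \<omega>\<bar>} + (\<bar>U\<bar> * \<eta>)\<^sup>2 \<le> 4 * (1 / (8 * a\<^sup>2)) + 1 / (4 * a\<^sup>2)"
        using elim(1) by linarith
      also have "\<dots> \<le> 1 / a\<^sup>2" using a by (simp add: field_simps)
      finally have v: "expectation (\<lambda>\<omega>. (norm (iexp (U * Z n 0 \<omega>) - 1))\<^sup>2) \<le> 1 / a\<^sup>2"
        using second_moment_le[of n \<eta> U] elim \<eta> by linarith
      have r: "0 < rate n" using rate_pos elim by simp
      \<comment> \<open>In the bounded range the inverse weight may be replaced by its lower bound
        1.\<close>
      have "t / 2 * rate n * 1 \<le> t / 2 * rate n * inverse (weight \<delta> U)"
        using r t inverse_weight_ge_1[OF \<open>0 \<le> \<delta>\<close>, of U] by (intro mult_left_mono) auto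
      then have "prob {\<omega> \<in> space M. t / 2 * rate n * inverse (weight \<delta> U) \<le> dev n U \<omega>}
          \<le> prob {\<omega> \<in> space M. t / 2 * rate n \<le> dev n U \<omega>}"
        by (intro finite_measure_mono) auto
      also have "\<dots> \<le> 4 * exp (- (a * rate n) * real n * (t / 2 * rate n / 2) + real n * (a * rate n)\<^sup>2 * (1 / a\<^sup>2))"
        using elim a r by (intro dev_tail v) (auto simp: field_simps)
      also have "- (a * rate n) * real n * (t / 2 * rate n / 2) + real n * (a * rate n)\<^sup>2 * (1 / a\<^sup>2)
          = (1 - a * t / 4) * (real n * (rate n)\<^sup>2)"
        using a by (simp add: power_mult_distrib field_simps power2_eq_square)
      also have "\<dots> = - (K + 2) * ln (real n)" using elim t by (simp add: rate_sq a_def field_simps)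
      also have "exp \<dots> = real n powr (- (K + 2))" using elim by (simp add: powr_def)
      finally show "prob {\<omega> \<in> space M. t / 2 * rate n * inverse (weight \<delta> U) \<le> dev n U \<omega>}
        \<le> 4 * real n powr (- (K + 2))" .
    qed
  qed
qed

section \<open>Large entries and the passage between grid points\<close>

definition excess :: "nat \<Rightarrow> 'a \<Rightarrow> real" where
  "excess n \<omega> = (\<Sum>i<n. indicator {z. r < \<bar>z\<bar>} (Z n i \<omega>) - prob {\<omega> \<in> space M. r < \<bar>Z n 0 \<omega>\<bar>})"

lemma measurable_excess [measurable]: "excess n \<in> borel_measurable M"
  unfolding excess_def
  by (rule measurable_sum_comp[of "\<lambda>z. indicator {z. r < \<bar>z\<bar>} z - _"]) measurable

text \<open>\<open>excess\<close> is the number of entries beyond \<open>r\<close> minus its mean.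
  The second moment of each indicator equals its probability, which is at most
  \<open>1 / n\<close>.\<close>

lemma excess_tail:
  assumes t: "0 < t" and "0 \<le> K"
  shows "\<forall>\<^sub>F n in sequentially.
    prob {\<omega> \<in> space M. real n * (t * rate n) \<le> excess n \<omega>} \<le> real n powr (- K)"
proof -
  \<comment> \<open>The exponent becomes \<open>(a\<^sup>2 * p - a * t) * ln n\<close> with
    \<open>p\<close> the probability of a large entry; here \<open>a * t = K + 1\<close>, and
    \<open>a\<^sup>2 * p \<le> 1\<close> as soon as \<open>a\<^sup>2 \<le> n\<close>.\<close>
  define a where "a = (K + 1) / t"
  have a: "0 < a" using assms by (simp add: a_def)
  have "\<forall>\<^sub>F n in sequentially. rate n < 1 / (4 * a)"
    using order_tendstoD(2)[OF rate_tendsto_0] a by simp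
  moreover have "\<forall>\<^sub>F n in sequentially. a\<^sup>2 \<le> real n"
    by real_asymp
  ultimately show ?thesis using eventually_ge_at_top[of 3]
  proof eventually_elim
    case (elim n)
    let ?p = "prob {\<omega> \<in> space M. r < \<bar>Z n 0 \<omega>\<bar>}"
    let ?f = "indicator {z. r < \<bar>z\<bar>} :: real \<Rightarrow> real"
    have [measurable]: "Z n 0 \<in> borel_measurable M" using rv elim by auto
    have f [measurable]: "?f \<in> borel_measurable borel" by measurable
    have E0: "expectation (\<lambda>\<omega>. ?f (Z n 0 \<omega>)) = ?p"
    proof -
      have "expectation (\<lambda>\<omega>. ?f (Z n 0 \<omega>)) = expectation (indicator {\<omega> \<in> space M. r < \<bar>Z n 0 \<omega>\<bar>})"
        by (intro Bochner_Integration.integral_cong) (auto simp: indicator_def)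
      also have "\<dots> = ?p" by (simp add: Int_absorb2 Collect_restrict)
      finally show ?thesis .
    qed
    have E: "expectation (\<lambda>\<omega>. ?f (Z n i \<omega>)) = ?p" if "i < n" for i
      using expectation_ident[OF that f] E0 by simp
    have "(?f z)\<^sup>2 = ?f z" for z by (simp add: indicator_def)
    note sq = this
    have r: "0 < rate n" using rate_pos elim by simp
    have p: "a\<^sup>2 * ?p \<le> 1"
      using mult_right_mono[OF elim(2), of ?p] prob_large[of n] elim by auto
    have "prob {\<omega> \<in> space M. real n * (t * rate n) \<le> excess n \<omega>}
        \<le> exp (- (a * rate n) * real n * (t * rate n) + real n * (a * rate n)\<^sup>2 * ?p)"
      unfolding excess_def
    proof (rule bernstein_upper)
      show "indep_vars (\<lambda>_. borel) (\<lambda>i \<omega>. ?f (Z n i \<omega>)) {..<n}"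
        using elim by (intro indep_vars_compose2[OF indep]) auto
    qed (use a r elim E sq in \<open>auto simp: field_simps indicator_def\<close>)
    also have "- (a * rate n) * real n * (t * rate n) + real n * (a * rate n)\<^sup>2 * ?p
        = (a\<^sup>2 * ?p - a * t) * (real n * (rate n)\<^sup>2)"
      by (simp add: power_mult_distrib field_simps power2_eq_square)
    also have "\<dots> = (a\<^sup>2 * ?p - (K + 1)) * ln (real n)" using elim t by (simp add: rate_sq a_def)
    also have "exp \<dots> \<le> exp (- K * ln (real n))"
    proof -
      have "(a\<^sup>2 * ?p - (K + 1)) * ln (real n) \<le> - K * ln (real n)"
        using p elim by (intro mult_right_mono) auto
      then show ?thesis by simp
    qed
    also have "\<dots> = real n powr (- K)" using elim by (simp add: powr_def)
    finally show ?case .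
  qed
qed

text \<open>An entry within \<open>r\<close> changes its exponential by at most
  \<open>r / n\<close>, a larger one by at most 2. The number of larger ones is
  \<open>excess\<close> plus its mean, and that mean is at most 1. The error does not depend on
  \<open>U\<close> and \<open>V\<close>, so a single exceptional event serves all
  frequencies.\<close>

lemma dev_interpolate:
  assumes n: "1 \<le> n" and UV: "\<bar>U - V\<bar> \<le> 1 / real n"
  shows "dev n U \<omega> \<le> dev n V \<omega> + (2 * r + 4) / real n + 2 * excess n \<omega> / real n"
proof -
  let ?p = "prob {\<omega> \<in> space M. r < \<bar>Z n 0 \<omega>\<bar>}"
  let ?f = "indicator {z. r < \<bar>z\<bar>} :: real \<Rightarrow> real"
  have [measurable]: "Z n 0 \<in> borel_measurable M" using rv n by auto
  have pt: "norm (iexp (U * z) - iexp (V * z)) \<le> r / real n + 2 * ?f z" for z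
  proof (cases "r < \<bar>z\<bar>")
    case True
    then show ?thesis using norm_triangle_ineq4[of "iexp (U * z)" "iexp (V * z)"] r_nonneg
      by (simp add: add_increasing)
  next
    case False
    have "norm (iexp (U * z) - iexp (V * z)) \<le> \<bar>U * z - V * z\<bar>" by (rule norm_iexp_diff_le)
    also have "\<dots> = \<bar>U - V\<bar> * \<bar>z\<bar>" by (simp add: abs_mult[symmetric] algebra_simps)
    also have "\<dots> \<le> 1 / real n * r" using UV False by (intro mult_mono) auto
    finally show ?thesis using False by simp
  qed
  let ?e = "\<lambda>U. (1 / of_nat n) * (\<Sum>i<n. iexp (U * Z n i \<omega>))"
  let ?c = "\<lambda>U. expectation (\<lambda>\<omega>. iexp (U * Z n 0 \<omega>))"
  have "norm (?e U - ?e V) = norm (\<Sum>i<n. iexp (U * Z n i \<omega>) - iexp (V * Z n i \<omega>)) / real n"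
    by (simp add: sum_subtractf diff_divide_distrib[symmetric] norm_divide)
  also have "\<dots> \<le> (\<Sum>i<n. r / real n + 2 * ?f (Z n i \<omega>)) / real n"
    using pt by (intro divide_right_mono sum_norm_le) auto
  also have "(\<Sum>i<n. r / real n + 2 * ?f (Z n i \<omega>)) = r + 2 * (excess n \<omega> + real n * ?p)"
    using n by (simp add: excess_def sum.distrib sum_subtractf sum_distrib_left)
  finally have e: "norm (?e U - ?e V) \<le> (r + 2 * (excess n \<omega> + real n * ?p)) / real n" .
  have f_int: "integrable M (\<lambda>\<omega>. ?f (Z n 0 \<omega>))"
    by (intro integrable_const_bound[where B=1]) (auto simp: indicator_def)
  have "norm (?c U - ?c V) = norm (expectation (\<lambda>\<omega>. iexp (U * Z n 0 \<omega>) - iexp (V * Z n 0 \<omega>)))"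
    using iexp_integrable[OF n] by simp
  also have "\<dots> \<le> expectation (\<lambda>\<omega>. norm (iexp (U * Z n 0 \<omega>) - iexp (V * Z n 0 \<omega>)))"
    by (rule integral_norm_bound)
  also have "\<dots> \<le> expectation (\<lambda>\<omega>. r / real n + 2 * ?f (Z n 0 \<omega>))"
    using iexp_integrable[OF n] f_int pt by (intro integral_mono) auto
  also have "\<dots> = r / real n + 2 * ?p"
  proof -
    have "expectation (\<lambda>\<omega>. ?f (Z n 0 \<omega>)) = expectation (indicator {\<omega> \<in> space M. r < \<bar>Z n 0 \<omega>\<bar>})"
      by (intro Bochner_Integration.integral_cong) (auto simp: indicator_def)
    also have "\<dots> = ?p" by (simp add: Int_absorb2 Collect_restrict)
    finally show ?thesis using f_int by (simp add: prob_space)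
  qed
  finally have c: "norm (?c U - ?c V) \<le> r / real n + 2 * ?p" .
  have "dev n U \<omega> = norm ((?e V - ?c V) + (?e U - ?e V) - (?c U - ?c V))"
    by (simp add: dev_def)
  also have "\<dots> \<le> dev n V \<omega> + norm (?e U - ?e V) + norm (?c U - ?c V)"
    unfolding dev_def by (intro order_trans[OF norm_triangle_ineq4] add_right_mono norm_triangle_ineq)
  also have "\<dots> \<le> dev n V \<omega> + (r + 2 * (excess n \<omega> + real n * ?p)) / real n + (r / real n + 2 * ?p)"
    using e c by linarith
  also have "\<dots> = dev n V \<omega> + (2 * r + 4 * (real n * ?p)) / real n + 2 * excess n \<omega> / real n"
    using n by (simp add: field_simps)
  also have "\<dots> \<le> dev n V \<omega> + (2 * r + 4) / real n + 2 * excess n \<omega> / real n"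
    using prob_large[OF n] by (intro add_mono divide_right_mono) auto
  finally show ?thesis .
qed

text \<open>The event is covered by one event for an excess of large entries and one event for each
  grid point \<open>m / n\<close>. The latter have probability of order
  \<open>n powr (- K) / (m + 1)\<^sup>2\<close>, which is summable over the infinite grid.\<close>

lemma sup_deviation_tail:
  fixes t K \<delta> :: real
  assumes t: "0 < t" and K: "0 \<le> K" and \<delta>: "0 < \<delta>"
  shows "\<exists>C. \<forall>\<^sub>F n in sequentially.
    prob {\<omega> \<in> space M. \<exists>U. t * rate n * inverse (weight \<delta> U) \<le> dev n U \<omega>} \<le> C * real n powr (- K)"
proof -
  \<comment> \<open>\<open>R\<close> is the radius from which
    \<open>ln (exp 1 + \<bar>U\<bar>) powr (2 * \<delta>)\<close> is at least \<open>b\<close>, and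
    \<open>t\<^sup>2 / 256 * b\<close> is the constant \<open>K + 4\<close> required for large
    frequencies.\<close>
  define b where "b = 256 * (K + 4) / t\<^sup>2"
  define R where "R = exp (b powr (1 / (2 * \<delta>)))"
  have b: "0 < b" using t K by (simp add: b_def)
  have R: "0 < R" by (simp add: R_def)
  have far: "K + 4 \<le> t\<^sup>2 / 256 * ln (exp 1 + \<bar>U\<bar>) powr (2 * \<delta>)" if "R \<le> \<bar>U\<bar>" for U
  proof -
    have "ln (exp 1 + \<bar>U\<bar>) \<ge> ln R" using that R by (intro ln_mono) (auto intro: add_pos_nonneg add_increasing)
    then have "(b powr (1 / (2 * \<delta>))) powr (2 * \<delta>) \<le> ln (exp 1 + \<bar>U\<bar>) powr (2 * \<delta>)"
      using \<delta> by (intro powr_mono2) (auto simp: R_def)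
    also have "(b powr (1 / (2 * \<delta>))) powr (2 * \<delta>) = b" using b \<delta> by (simp add: powr_powr)
    finally have "t\<^sup>2 / 256 * b \<le> t\<^sup>2 / 256 * ln (exp 1 + \<bar>U\<bar>) powr (2 * \<delta>)"
      by (intro mult_left_mono) auto
    then show ?thesis using t by (simp add: b_def)
  qed
  define F where "F n m = {\<omega> \<in> space M. t / 2 * rate n * inverse (weight \<delta> (real m / real n))
      \<le> dev n (real m / real n) \<omega>}" for n m :: nat
  define G where "G n = {\<omega> \<in> space M. real n * (t / 16 * rate n) \<le> excess n \<omega>}" for n
  \<comment> \<open>Far grid points need the constant 4, near ones
    \<open>4 * (R + 1)\<^sup>2\<close>; \<open>c\<close> covers both.\<close>
  define c where "c = 4 * (R + 1)\<^sup>2"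
  have [measurable]: "F n m \<in> sets M" "G n \<in> sets M" for n m by (simp_all add: F_def G_def)
  have "\<forall>\<^sub>F n in sequentially. \<forall>U. \<bar>U\<bar> \<le> R \<longrightarrow>
      prob {\<omega> \<in> space M. t / 2 * rate n * inverse (weight \<delta> U) \<le> dev n U \<omega>}
        \<le> 4 * real n powr (- (K + 2))"
    using t K \<delta> R by (intro deviation_near) auto
  moreover have "\<forall>\<^sub>F n in sequentially. prob (G n) \<le> real n powr (- K)"
    unfolding G_def using t K by (intro excess_tail) auto
  moreover have "\<forall>\<^sub>F n in sequentially. (2 * r + 4) / real n \<le> t / 4 * rate n"
    using t by (intro eventually_rate_ge) auto
  ultimately have "\<forall>\<^sub>F n in sequentially.
    prob {\<omega> \<in> space M. \<exists>U. t * rate n * inverse (weight \<delta> U) \<le> dev n U \<omega>}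
      \<le> (1 + c * (pi\<^sup>2 / 6)) * real n powr (- K)"
    using eventually_ge_at_top[of 3]
  proof eventually_elim
    case (elim n)
    have rate: "0 < rate n" using rate_pos elim by simp
    have K2: "real n powr (- (K + 2)) = real n powr (- K) / (real n)\<^sup>2"
      using elim by (simp add: powr_diff)
    have F: "prob (F n m) \<le> c * real n powr (- K) * (1 / (real m + 1)\<^sup>2)" for m
    proof (cases "R \<le> real m / real n")
      case True
      have "prob (F n m) \<le> 4 * real n powr (- (K + 2)) / (exp 1 + \<bar>real m / real n\<bar>)\<^sup>2"
        unfolding F_def using True elim t K by (intro deviation_far far) auto
      also have "\<dots> = 4 * real n powr (- K) / (exp 1 * real n + real m)\<^sup>2"
      proof -
        have "real n * (exp 1 + \<bar>real m / real n\<bar>) = exp 1 * real n + real m"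
          using elim by (simp add: field_simps)
        then show ?thesis unfolding K2 by (simp add: power_mult_distrib[symmetric])
      qed
      also have "\<dots> \<le> 4 * real n powr (- K) / (real m + 1)\<^sup>2"
      proof (intro divide_left_mono power_mono)
        have "1 * 1 \<le> exp 1 * real n" using elim by (intro mult_mono) auto
        then show "real m + 1 \<le> exp 1 * real n + real m" by simp
        then show "0 < (exp 1 * real n + real m)\<^sup>2 * (real m + 1)\<^sup>2"
          by (smt (verit) mult_pos_pos of_nat_0_le_iff zero_less_power)
      qed auto
      also have "\<dots> = 4 * 1 * (real n powr (- K) / (real m + 1)\<^sup>2)" by simp
      also have "\<dots> \<le> c * (real n powr (- K) / (real m + 1)\<^sup>2)"
        unfolding c_def using R by (intro mult_right_mono mult_left_mono) auto
      finally show ?thesis by simp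
    next
      case False
      have "prob (F n m) \<le> 4 * real n powr (- (K + 2))"
        unfolding F_def using elim(1) False by auto
      also have "\<dots> = 4 * real n powr (- K) * (1 / (real n)\<^sup>2)" unfolding K2 by simp
      also have "\<dots> \<le> 4 * real n powr (- K) * ((R + 1)\<^sup>2 / (real m + 1)\<^sup>2)"
      proof (rule mult_left_mono)
        \<comment> \<open>For near grid points this exchanges the surplus factor
          \<open>1 / n\<^sup>2\<close> for the summable \<open>1 / (m + 1)\<^sup>2\<close>.\<close>
        have "real m + 1 \<le> (R + 1) * real n" using False elim by (simp add: field_simps)
        then have "(real m + 1)\<^sup>2 \<le> ((R + 1) * real n)\<^sup>2" by (intro power_mono) auto
        then have "(real m + 1)\<^sup>2 \<le> (R + 1)\<^sup>2 * (real n)\<^sup>2" by (simp only: power_mult_distrib)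
        then show "1 / (real n)\<^sup>2 \<le> (R + 1)\<^sup>2 / (real m + 1)\<^sup>2" using elim(4) by (simp add: pos_divide_le_eq pos_le_divide_eq mult_ac)
      qed simp
      finally show ?thesis unfolding c_def by (simp add: mult_ac)
    qed
    have sums: "(\<lambda>m. c * real n powr (- K) * (1 / (real m + 1)\<^sup>2)) sums (c * real n powr (- K) * (pi\<^sup>2 / 6))"
      using inverse_squares_sums by (intro sums_mult) (simp add: add.commute)
    have sF: "summable (\<lambda>m. prob (F n m))"
      using F by (intro summable_comparison_test[OF _ sums_summable[OF sums]]) auto
    have "prob (\<Union>m. F n m) \<le> (\<Sum>m. prob (F n m))"
      using sF by (intro finite_measure_subadditive_countably) auto
    also have "\<dots> \<le> c * real n powr (- K) * (pi\<^sup>2 / 6)"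
      using suminf_le[OF F sF sums_summable[OF sums]] sums_unique[OF sums] by simp
    finally have UF: "prob (\<Union>m. F n m) \<le> c * real n powr (- K) * (pi\<^sup>2 / 6)" .
    have "{\<omega> \<in> space M. \<exists>U. t * rate n * inverse (weight \<delta> U) \<le> dev n U \<omega>} \<subseteq> G n \<union> (\<Union>m. F n m)"
    proof
      fix \<omega> assume "\<omega> \<in> {\<omega> \<in> space M. \<exists>U. t * rate n * inverse (weight \<delta> U) \<le> dev n U \<omega>}"
      then obtain V where \<omega>: "\<omega> \<in> space M" and V: "t * rate n * inverse (weight \<delta> V) \<le> dev n V \<omega>"
        by auto
      define U where "U = \<bar>V\<bar>"
      have U: "0 \<le> U" "t * rate n * inverse (weight \<delta> U) \<le> dev n U \<omega>"
        using V dev_uminus[of n V \<omega>] by (auto simp: U_def weight_def abs_if split: if_splits)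
      \<comment> \<open>Rounding down keeps the grid point below \<open>U\<close>, where the inverse
        weight is no larger than at \<open>U\<close>.\<close>
      define m where "m = nat \<lfloor>real n * U\<rfloor>"
      have m: "real m \<le> real n * U" "real n * U < real m + 1"
        using U by (auto simp: m_def)
      let ?V = "real m / real n"
      have "?V \<le> U" "U \<le> (real m + 1) / real n"
        using m elim(4) by (simp_all add: pos_divide_le_eq pos_le_divide_eq mult.commute)
      then have mV: "?V \<le> U" "\<bar>U - ?V\<bar> \<le> 1 / real n"
        by (simp_all add: add_divide_distrib)
      show "\<omega> \<in> G n \<union> (\<Union>m. F n m)"
      proof (rule ccontr)
        assume "\<omega> \<notin> G n \<union> (\<Union>m. F n m)"
        then have 1: "excess n \<omega> < real n * (t / 16 * rate n)"
          and 2: "dev n ?V \<omega> < t / 2 * rate n * inverse (weight \<delta> ?V)"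
          using \<omega> by (auto simp: F_def G_def not_le)
        have 1: "2 * excess n \<omega> / real n < t / 8 * rate n" using 1 elim by (simp add: field_simps)
        have w: "1 \<le> inverse (weight \<delta> U)" "inverse (weight \<delta> ?V) \<le> inverse (weight \<delta> U)"
          using \<delta> mV U(1) by (auto intro!: inverse_weight_ge_1 inverse_weight_mono)
        have "dev n U \<omega> \<le> dev n ?V \<omega> + (2 * r + 4) / real n + 2 * excess n \<omega> / real n"
          using mV elim by (intro dev_interpolate) auto
        \<comment> \<open>The threshold is shared out: \<open>t / 2\<close> for the grid point,
          \<open>t / 4\<close> for the deterministic interpolation error and \<open>t / 8\<close>
          for the excess. Since the inverse weight is at least 1, the last two fit into the
          remaining half.\<close>
        also have "\<dots> < t / 2 * rate n * inverse (weight \<delta> ?V) + t / 4 * rate n + t / 8 * rate n"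
          using 1 2 elim by linarith
        also have "\<dots> \<le> t / 2 * rate n * inverse (weight \<delta> U) + t / 2 * rate n * 1"
        proof -
          have "t / 2 * rate n * inverse (weight \<delta> ?V) \<le> t / 2 * rate n * inverse (weight \<delta> U)"
            using w t rate by (intro mult_left_mono) auto
          then show ?thesis using mult_pos_pos[OF t rate] by linarith
        qed
        also have "\<dots> \<le> t / 2 * rate n * inverse (weight \<delta> U) + t / 2 * rate n * inverse (weight \<delta> U)"
          using w t rate by (intro add_left_mono mult_left_mono) auto
        also have "\<dots> = t * rate n * inverse (weight \<delta> U)" by simp
        finally show False using U by simp
      qed
    qed
    then have "prob {\<omega> \<in> space M. \<exists>U. t * rate n * inverse (weight \<delta> U) \<le> dev n U \<omega>}
        \<le> prob (G n \<union> (\<Union>m. F n m))" by (intro finite_measure_mono) auto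
    also have "\<dots> \<le> prob (G n) + prob (\<Union>m. F n m)" by (intro measure_Un_le) auto
    also have "\<dots> \<le> real n powr (- K) + c * real n powr (- K) * (pi\<^sup>2 / 6)"
      using elim UF by linarith
    finally show ?case by (simp add: algebra_simps)
  qed
  then show ?thesis by blast
qed

end

section \<open>Increments of Levy processes\<close>

text \<open>From \<open>(1 - p) ^ n \<le> exp (- (n * p))\<close> follows
  \<open>exp (n * p) \<le> 2\<close>, and \<open>1 + n * p\<close> lies below this
  exponential.\<close>

lemma mult_le_1_if_half_le_power:
  fixes p :: real
  assumes "0 \<le> p" "p \<le> 1" "1 / 2 \<le> (1 - p) ^ n"
  shows "real n * p \<le> 1"
proof -
  have "(1 - p) ^ n \<le> exp (- p) ^ n" using exp_minus_ge assms by (intro power_mono) auto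
  also have "\<dots> = exp (- (real n * p))" by (simp add: exp_of_nat_mult[symmetric])
  finally have "1 / 2 \<le> exp (- (real n * p))" using assms(3) by linarith
  then have "exp (real n * p) \<le> 2" by (simp add: exp_minus field_simps)
  moreover have "1 + real n * p \<le> exp (real n * p)" by simp
  ultimately show ?thesis by linarith
qed

context levy_process
begin

text \<open>Rational times make the union countable and still contain every observation time
  \<open>i / n\<close>.\<close>

lemma measurable_exceedance [measurable]:
  "{\<omega> \<in> space M. \<exists>q\<in>\<rat> \<inter> {0..1}. b < norm (X q \<omega>)} \<in> sets M"
proof -
  have "{\<omega> \<in> space M. \<exists>q\<in>\<rat> \<inter> {0..1}. b < norm (X q \<omega>)}
      = (\<Union>q\<in>\<rat> \<inter> {0..1}. {\<omega> \<in> space M. b < norm (X q \<omega>)})" by auto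
  also have "\<dots> \<in> sets M"
  proof (rule sets.countable_UN'')
    show "countable (\<rat> \<inter> {0..1::real})" using countable_rat by blast
    fix q :: real assume "q \<in> \<rat> \<inter> {0..1}"
    then have [measurable]: "X q \<in> borel_measurable M" using measurable_X by simp
    show "{\<omega> \<in> space M. b < norm (X q \<omega>)} \<in> sets M" by measurable
  qed
  finally show ?thesis .
qed

text \<open>Almost every path is bounded on [0, 1], so the exceedance events decrease to a null set
  as the bound grows.\<close>

lemma exists_bound_unit_interval:
  "\<exists>B::nat. prob {\<omega> \<in> space M. \<exists>q\<in>\<rat> \<inter> {0..1}. real B < norm (X q \<omega>)} \<le> 1 / 2"
proof -
  define E where "E k = {\<omega> \<in> space M. \<exists>q\<in>\<rat> \<inter> {0..1}. real k < norm (X q \<omega>)}" for k :: nat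
  have E: "E k \<in> sets M" for k unfolding E_def by (rule measurable_exceedance)
  have "AE \<omega> in M. \<omega> \<notin> (\<Inter>k. E k)"
    using cadlag_paths
  proof eventually_elim
    case (elim \<omega>)
    have "\<exists>B. \<forall>s\<in>{0..1}. norm (X s \<omega>) \<le> B"
      by (rule cadlag_bounded_on_Icc) (use elim in auto)
    then obtain B where B: "\<forall>s\<in>{0..1}. norm (X s \<omega>) \<le> B" by blast
    obtain k :: nat where "B \<le> real k" using real_arch_simple by blast
    then have "\<omega> \<notin> E k" using B by (auto simp: E_def not_less intro: order_trans)
    then show ?case by blast
  qed
  then have "prob (\<Inter>k. E k) = 0"
    using E by (intro prob_eq_0[THEN iffD2]) auto
  moreover have "(\<lambda>k. prob (E k)) \<longlonglongrightarrow> prob (\<Inter>k. E k)"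
  proof (rule finite_Lim_measure_decseq)
    show "decseq E" unfolding decseq_def E_def
    proof (intro allI impI subsetI)
      fix m n :: nat and \<omega>
      assume mn: "m \<le> n" and "\<omega> \<in> {\<omega> \<in> space M. \<exists>q\<in>\<rat> \<inter> {0..1}. real n < norm (X q \<omega>)}"
      moreover have "real m < x" if "real n < x" for x using mn that by linarith
      ultimately show "\<omega> \<in> {\<omega> \<in> space M. \<exists>q\<in>\<rat> \<inter> {0..1}. real m < norm (X q \<omega>)}" by blast
    qed
  qed (use E in auto)
  ultimately have "\<forall>\<^sub>F k in sequentially. prob (E k) < 1 / 2"
    using order_tendstoD(2)[of "\<lambda>k. prob (E k)" 0 sequentially "1/2"] by simp
  then obtain k where "prob (E k) < 1 / 2" by (auto simp: eventually_sequentially)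
  then show ?thesis unfolding E_def by (intro exI[of _ k]) auto
qed

end

text \<open>If the path stays within \<open>B\<close> at all rational times of [0, 1], all
  increments of all rows are at most \<open>2 * B\<close> in norm; this gives an \<open>r\<close>
  independent of \<open>n\<close>. Stochastic continuity at 0 makes the array null.\<close>

lemma (in levy_process) increments_null_array:
  fixes g :: "'b \<Rightarrow> real"
  assumes g: "bounded_linear g"
  shows "\<exists>r. null_array M (\<lambda>n i \<omega>. g (X (real (Suc i) / real n) \<omega> - X (real i / real n) \<omega>)) r"
proof -
  interpret g: bounded_linear g by (rule g)
  have [measurable]: "g \<in> borel_measurable borel"
    by (intro borel_measurable_continuous_onI g.continuous_on continuous_on_id)
  obtain C where C: "0 < C" "\<And>x. \<bar>g x\<bar> \<le> C * norm x"
    using g.pos_bounded by (auto simp: mult.commute)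
  obtain B :: nat where B: "prob {\<omega> \<in> space M. \<exists>q\<in>\<rat> \<inter> {0..1}. real B < norm (X q \<omega>)} \<le> 1 / 2"
    using exists_bound_unit_interval by blast
  define D where "D n i \<omega> = X (real (Suc i) / real n) \<omega> - X (real i / real n) \<omega>" for n i \<omega>
  define r where "r = C * (2 * real B)"
  have X [measurable]: "X (real i / real n) \<in> borel_measurable M" for i n :: nat
    by (intro measurable_X) simp
  have D [measurable]: "D n i \<in> borel_measurable M" for n i
    unfolding D_def by measurable
  have indep: "indep_vars (\<lambda>_. borel) (D n) {..<n}" for n
    using independent_increments[of "\<lambda>i. real i / real n" n]
    by (simp add: D_def[abs_def] divide_right_mono)
  have law: "distr M borel (D n i) = distr M borel (X (1 / real n))" if "1 \<le> n" for n i
  proof -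
    have "real i / real n + 1 / real n = real (Suc i) / real n" by (simp add: add_divide_distrib)
    then show ?thesis
      using stationary_increments[of "real i / real n" "1 / real n"] by (simp add: D_def[abs_def])
  qed
  have prob_D: "prob {\<omega> \<in> space M. P (D n i \<omega>)} = prob {\<omega> \<in> space M. P (X (1 / real n) \<omega>)}"
    if "1 \<le> n" and [measurable]: "Measurable.pred borel P" for n i P
  proof -
    have [measurable]: "X (1 / real n) \<in> borel_measurable M" by (intro measurable_X) simp
    have "prob {\<omega> \<in> space M. P (D n i \<omega>)} = measure (distr M borel (D n i)) {x. P x}"
      by (subst measure_distr) (auto intro!: arg_cong[where f=prob])
    also have "\<dots> = prob {\<omega> \<in> space M. P (X (1 / real n) \<omega>)}"
      unfolding law[OF \<open>1 \<le> n\<close>] by (subst measure_distr) (auto intro!: arg_cong[where f=prob])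
    finally show ?thesis .
  qed
  have "null_array M (\<lambda>n i \<omega>. g (D n i \<omega>)) r"
  proof unfold_locales
    show "0 \<le> r" using C by (simp add: r_def)
    show "indep_vars (\<lambda>_. borel) (\<lambda>i \<omega>. g (D n i \<omega>)) {..<n}" for n
      by (intro indep_vars_compose2[OF indep]) measurable
    show "distr M borel (\<lambda>\<omega>. g (D n i \<omega>)) = distr M borel (\<lambda>\<omega>. g (D n 0 \<omega>))" if "i < n" for n i
    proof -
      have "distr M borel (\<lambda>\<omega>. g (D n i \<omega>)) = distr (distr M borel (D n i)) borel g" for i
        by (subst distr_distr) (auto simp: comp_def)
      then show ?thesis using law[of n] that by simp
    qed
  next
    fix n :: nat assume n: "1 \<le> n"
    define p where "p = prob {\<omega> \<in> space M. r < \<bar>g (D n 0 \<omega>)\<bar>}"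
    let ?A = "\<lambda>i. D n i -` {x. \<bar>g x\<bar> \<le> r} \<inter> space M"
    have A: "prob (?A i) = 1 - p" for i
    proof -
      have "prob (?A i) = prob (space M - {\<omega> \<in> space M. r < \<bar>g (D n i \<omega>)\<bar>})"
        by (intro arg_cong[where f=prob]) auto
      also have "\<dots> = 1 - prob {\<omega> \<in> space M. r < \<bar>g (D n i \<omega>)\<bar>}"
        by (rule prob_compl) measurable
      also have "prob {\<omega> \<in> space M. r < \<bar>g (D n i \<omega>)\<bar>} = p"
        unfolding p_def using prob_D[OF n, of "\<lambda>x. r < \<bar>g x\<bar>"] by simp
      finally show ?thesis .
    qed
    \<comment> \<open>Independence turns the probability that no entry of the row exceeds
      \<open>r\<close> into \<open>(1 - p) ^ n\<close>; the path bound then shows it is at least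
      1/2, which forces \<open>n * p \<le> 1\<close>.\<close>
    have "prob (\<Inter>i<n. ?A i) = (\<Prod>i<n. prob (?A i))"
      using n by (intro indep_varsD_finite[OF indep]) (auto simp: lessThan_empty_iff)
    then have pow: "prob (\<Inter>i<n. ?A i) = (1 - p) ^ n" using A by simp
    let ?E = "\<lambda>q. {\<omega> \<in> space M. real B < norm (X q \<omega>)}"
    let ?F = "\<Union>i\<le>n. ?E (real i / real n)"
    have "?F \<subseteq> {\<omega> \<in> space M. \<exists>q\<in>\<rat> \<inter> {0..1}. real B < norm (X q \<omega>)}"
    proof -
      have "real i / real n \<in> \<rat> \<inter> {0..1}" if "i \<le> n" for i using that n by auto
      then show ?thesis by blast
    qed
    then have "prob ?F \<le> 1 / 2"
      using finite_measure_mono[of ?F, OF _ measurable_exceedance] B by force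
    then have "1 / 2 \<le> prob (space M - ?F)"
      by (subst prob_compl) auto
    also have "\<dots> \<le> prob (\<Inter>i<n. ?A i)"
    proof (rule finite_measure_mono)
      show "(\<Inter>i<n. ?A i) \<in> sets M" using n by (intro sets.finite_INT) (auto simp: lessThan_empty_iff)
      show "space M - ?F \<subseteq> (\<Inter>i<n. ?A i)"
      proof clarsimp
        fix \<omega> i assume \<omega>: "\<omega> \<in> space M" "\<forall>i\<in>{..n}. \<not> real B < norm (X (real i / real n) \<omega>)" and i: "i < n"
        have le: "norm (X (real j / real n) \<omega>) \<le> real B" if "j \<le> n" for j
          using \<omega>(2) that by (auto simp: not_less)
        have "norm (D n i \<omega>) \<le> real B + real B"
          unfolding D_def using i by (intro order_trans[OF norm_triangle_ineq4] add_mono le) auto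
        then have "C * norm (D n i \<omega>) \<le> C * (2 * real B)" using C by (intro mult_left_mono) auto
        then show "\<bar>g (D n i \<omega>)\<bar> \<le> r" using C(2)[of "D n i \<omega>"] unfolding r_def by linarith
      qed
    qed
    finally have "1 / 2 \<le> (1 - p) ^ n" unfolding pow .
    then show "real n * prob {\<omega> \<in> space M. r < \<bar>g (D n 0 \<omega>)\<bar>} \<le> 1"
      unfolding p_def[symmetric] by (intro mult_le_1_if_half_le_power) (auto simp: p_def)
  next
    fix \<eta> :: real assume \<eta>: "0 < \<eta>"
    let ?P = "\<lambda>s. prob {\<omega> \<in> space M. \<eta> / C < dist (X s \<omega>) (X 0 \<omega>)}"
    have "(?P \<longlongrightarrow> 0) (at 0 within {0..})"
      using stochastically_continuous[of 0 "\<eta> / C"] \<eta> C by simp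
    moreover have "filterlim (\<lambda>n. 1 / real n) (at 0 within {0..}) sequentially"
      unfolding filterlim_at using eventually_gt_at_top[of 0]
      by (auto intro!: lim_1_over_n elim!: eventually_mono)
    ultimately have lim: "(\<lambda>n. ?P (1 / real n)) \<longlonglongrightarrow> 0" by (rule filterlim_compose)
    show "(\<lambda>n. prob {\<omega> \<in> space M. \<eta> < \<bar>g (D n 0 \<omega>)\<bar>}) \<longlonglongrightarrow> 0"
    proof (rule tendsto_sandwich[OF _ _ tendsto_const lim])
      show "\<forall>\<^sub>F n in sequentially. prob {\<omega> \<in> space M. \<eta> < \<bar>g (D n 0 \<omega>)\<bar>} \<le> ?P (1 / real n)"
      \<comment> \<open>The comparison holds for \<open>n = 0\<close> as well: division by zero
        gives 0, so only \<open>X 0\<close> occurs there.\<close>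
      proof (intro always_eventually allI finite_measure_mono subsetI)
        fix n
        have [measurable]: "X (1 / real n) \<in> borel_measurable M" "X 0 \<in> borel_measurable M"
          by (intro measurable_X; simp)+
        show "{\<omega> \<in> space M. \<eta> / C < dist (X (1 / real n) \<omega>) (X 0 \<omega>)} \<in> events" by measurable
        fix \<omega> assume "\<omega> \<in> {\<omega> \<in> space M. \<eta> < \<bar>g (D n 0 \<omega>)\<bar>}"
        moreover have "\<bar>g (D n 0 \<omega>)\<bar> \<le> C * dist (X (1 / real n) \<omega>) (X 0 \<omega>)"
          using C(2)[of "D n 0 \<omega>"] by (simp add: D_def dist_norm)
        ultimately show "\<omega> \<in> {\<omega> \<in> space M. \<eta> / C < dist (X (1 / real n) \<omega>) (X 0 \<omega>)}"
          using C(1) by (auto simp: pos_divide_less_eq mult.commute)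
      qed
    qed auto
  qed
  then show ?thesis unfolding D_def by blast
qed

section \<open>Diagonal characteristic functions of the Levy process\<close>

theorem lemma2p5:
  fixes M :: "'a measure" and X :: "real \<Rightarrow> 'a \<Rightarrow> real \<times> real"
    and \<delta> c\<^sub>1 t \<beta> :: real
  assumes "levy_process M X"
    and "\<delta> > 0"
    and "talagrand_constant M X c\<^sub>1"
    and "t > 0"
    and "\<beta> > 0"
  shows "\<exists>L::real. \<forall>n::nat. n \<ge> 1 \<longrightarrow>
    measure M {\<omega> \<in> space M. \<exists>u\<in>diagonal. \<exists>U. u = (U, U) \<and>
        norm (empirical_cf X n u \<omega> - cf M X n u)
          \<ge> t * sqrt (ln (real n) / real n) * inverse (weight \<delta> U)}
      \<le> L * real n powr (- ((t - \<beta>)\<^sup>2 / c\<^sub>1))"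
proof -
  interpret levy_process M X by fact
  \<comment> \<open>On the diagonal the inner product with \<open>x\<close> is \<open>U\<close>
    times the sum of the coordinates, so the problem becomes one for a real-valued array.\<close>
  define g :: "real \<times> real \<Rightarrow> real" where "g x = fst x + snd x" for x
  define Z where "Z n i \<omega> = g (X (real (Suc i) / real n) \<omega> - X (real i / real n) \<omega>)" for n i \<omega>
  have g: "bounded_linear g"
    unfolding g_def by (intro bounded_linear_add bounded_linear_fst bounded_linear_snd)
  have [measurable]: "g \<in> borel_measurable borel"
    by (intro borel_measurable_continuous_onI bounded_linear.continuous_on[OF g] continuous_on_id)
  obtain r where "null_array M Z r"
    using increments_null_array[OF g] unfolding Z_def[abs_def] by blast
  then interpret Z: null_array M Z r .
  have dot: "(U, U) \<bullet> x = U * g x" for U x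
    by (cases x) (simp add: g_def inner_prod_def distrib_left)
  have cf: "cf M X n (U, U) = expectation (\<lambda>\<omega>. iexp (U * Z n 0 \<omega>))" if "1 \<le> n" for n U
  proof -
    have m [measurable]: "X (1 / real n) \<in> borel_measurable M" "X 0 \<in> borel_measurable M"
      by (intro measurable_X; simp)+
    \<comment> \<open>Since \<open>X 0 = 0\<close> almost surely, \<open>X (1 / n)\<close> may be
      replaced by the first increment.\<close>
    have "AE \<omega> in M. iexp ((U, U) \<bullet> X (1 / real n) \<omega>) = iexp (U * Z n 0 \<omega>)"
      using start_at_zero by eventually_elim (simp add: Z_def dot)
    then show ?thesis unfolding cf_def by (intro integral_cong_AE) (auto simp: Z_def dot)
  qed
  have empirical: "empirical_cf X n (U, U) \<omega> = (1 / of_nat n) * (\<Sum>i<n. iexp (U * Z n i \<omega>))" for n U \<omega>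
  proof -
    \<comment> \<open>Increments are numbered from 1, array entries from 0.\<close>
    have "(\<Sum>j=1..n. iexp ((U, U) \<bullet> increment X n j \<omega>)) = (\<Sum>i<n. iexp ((U, U) \<bullet> increment X n (Suc i) \<omega>))"
      by (rule sum.reindex_bij_witness[where i=Suc and j="\<lambda>j. j - 1"]) auto
    also have "\<dots> = (\<Sum>i<n. iexp (U * Z n i \<omega>))"
      by (simp add: dot increment_def Z_def)
    finally show ?thesis unfolding empirical_cf_def by simp
  qed
  define K where "K = (t - \<beta>)\<^sup>2 / c\<^sub>1"
  have K: "0 \<le> K" using assms by (simp add: K_def talagrand_constant_def)
  define S where "S n = {\<omega> \<in> space M. \<exists>u\<in>diagonal. \<exists>U. u = (U, U) \<and>
        norm (empirical_cf X n u \<omega> - cf M X n u)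
          \<ge> t * sqrt (ln (real n) / real n) * inverse (weight \<delta> U)}" for n
  have S: "S n = {\<omega> \<in> space M. \<exists>U. t * rate n * inverse (weight \<delta> U) \<le> Z.dev n U \<omega>}" if "1 \<le> n" for n
    using cf[OF that] by (auto simp: S_def diagonal_def empirical Z.dev_def rate_def)
  obtain C where "\<forall>\<^sub>F n in sequentially.
    prob {\<omega> \<in> space M. \<exists>U. t * rate n * inverse (weight \<delta> U) \<le> Z.dev n U \<omega>} \<le> C * real n powr (- K)"
    using Z.sup_deviation_tail[OF \<open>t > 0\<close> K \<open>\<delta> > 0\<close>] by blast
  then obtain N where "\<forall>n\<ge>N.
    prob {\<omega> \<in> space M. \<exists>U. t * rate n * inverse (weight \<delta> U) \<le> Z.dev n U \<omega>} \<le> C * real n powr (- K)"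
    unfolding eventually_sequentially by blast
  then have N: "prob (S n) \<le> C * real n powr (- K)" if "N \<le> n" "1 \<le> n" for n
    using S that by simp
  \<comment> \<open>For the finitely many \<open>n < N\<close> the trivial bound 1 is written as
    \<open>n powr K * n powr (- K)\<close>, whose first factor is at most
    \<open>N powr K\<close>.\<close>
  have "prob (S n) \<le> max C (real N powr K) * real n powr (- K)" if n: "1 \<le> n" for n
  proof (cases "N \<le> n")
    case True
    then have "prob (S n) \<le> C * real n powr (- K)" using N n by blast
    also have "\<dots> \<le> max C (real N powr K) * real n powr (- K)" by (intro mult_right_mono) auto
    finally show ?thesis .
  next
    case False
    have "prob (S n) \<le> 1" by simp
    also have "1 = real n powr K * real n powr (- K)" using n by (simp add: powr_add[symmetric])
    also have "\<dots> \<le> max C (real N powr K) * real n powr (- K)"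
      using False K by (intro mult_right_mono max.coboundedI2 powr_mono2) auto
    finally show ?thesis .
  qed
  then show ?thesis unfolding S_def K_def by blast
qed

end
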